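(* In the setting of the context (problem $\mathcal{SP}2$ with objective $Q_2(\boldsymbol a,\boldsymbol p)$), let $\boldsymbol a^*$ be the optimal resource block allocation, let $\mathcal K^*=\{k\in\mathcal K:\sum_{n\in\mathcal R}a^*_{k,n}=1\}$ (assumed nonempty), and for $k\in\mathcal K^*$ let $n_k^*$ be the resource block with $a^*_{k,n_k^*}=1$. For each $l\in\mathcal K^*$ let $\boldsymbol p_l^*$ denote the optimal solution of $$\min_{\{p_k\}_{k\in\mathcal K^*}}\ \rho_1\sum_{k\in\mathcal K^*}\frac{(\xi_d+\xi_M)p_k}{W^U\log_2\big(1+\frac{h_kp_k}{I_{n_k^*}+W^UN_0}\big)}+\rho_2\frac{\xi_d+\xi_M}{W^U\log_2\big(1+\frac{h_lp_l}{I_{n_l^*}+W^UN_0}\big)}$$ $$\text{s.t. }\ \frac{(I_{n_k^*}+W^UN_0)h_l}{(I_{n_l^*}+W^UN_0)h_k}\,p_l\le p_k,\quad 0\le p_k\le p_k^{\max},\qquad\forall k\in\mathcal K^*,$$ extended by $p_k=0$ for $k\notin\mathcal K^*$. Then the optimal transmission power of $\mathcal{SP}2$ is $$\boldsymbol p^*=\operatorname*{argmin}_{\boldsymbol p\in\{\boldsymbol p_l^*\}_{l\in\mathcal K^*}}Q_2(\boldsymbol a^*,\boldsymbol p).$$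
   Context: $\mathcal K$ is a finite set of users and $\mathcal R$ a finite set of uplink resource blocks (RBs). Positive constants: $\rho_1,\rho_2,\xi_d,\xi_M,W^U,N_0$, and $h_k,p_k^{\max}$ for each $k\in\mathcal K$; $I_n\ge0$ for $n\in\mathcal R$; $\delta_k\in\mathbb R$. Problem $\mathcal{SP}2$ is $$\min_{\boldsymbol a,\boldsymbol p}\ Q_2(\boldsymbol a,\boldsymbol p)=\sum_{k,n}a_{k,n}\delta_k+\rho_1\sum_{k,n}a_{k,n}\frac{(\xi_d+\xi_M)p_k}{W^U\log_2(1+\frac{h_kp_k}{I_n+W^UN_0})}+\rho_2\max_{k\in\mathcal K}\sum_na_{k,n}\frac{\xi_d+\xi_M}{W^U\log_2(1+\frac{h_kp_k}{I_n+W^UN_0})}$$ subject to $0\le p_k\le p_k^{\max}$, $a_{k,n}\in\{0,1\}$, $\sum_{n}a_{k,n}\le1$ for all $k$, $\sum_{k}a_{k,n}\le1$ for all $n$. Terms with $a_{k,n}=0$ are $0$; when $a_{k,n}=1$ and $p_k=0$ the transmission time is $+\infty$. Users that are assigned no RB do not transmit (power $0$). The problem indexed by $l$ is the version, for fixed $\boldsymbol a^*$, in which user $l$ is the communication straggler (the scheduled user with the largest transmission time). *)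

theory Defs
  imports "HOL-Library.Extended_Real"
begin

text \<open>Users and uplink resource blocks are the elements of two finite types
  \<open>'k\<close> and \<open>'r\<close>; the constants of the problem are collected in a record.\<close>

record ('k, 'r) uplink =
  rho1 :: real
  rho2 :: real
  xi_d :: real
  xi_M :: real
  W_U :: real
  N_0 :: real
  gain :: "'k \<Rightarrow> real"  \<comment> \<open>\<open>h\<^sub>k\<close>\<close>
  pmax :: "'k \<Rightarrow> real"
  interf :: "'r \<Rightarrow> real"  \<comment> \<open>\<open>I\<^sub>n\<close>\<close>
  delta :: "'k \<Rightarrow> real"

definition noise :: "('k, 'r) uplink \<Rightarrow> 'r \<Rightarrow> real" where
  "noise s n = interf s n + W_U s * N_0 s"

definition rate :: "('k, 'r) uplink \<Rightarrow> 'k \<Rightarrow> 'r \<Rightarrow> real \<Rightarrow> real" where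
  "rate s k n x = W_U s * log 2 (1 + gain s k * x / noise s n)"

text \<open>Division is carried out in the extended reals, where \<open>c / 0 = \<infinity>\<close> for \<open>c > 0\<close>,
  so a scheduled user with zero power has infinite transmission time. Its energy is
  \<open>0 / 0 = 0\<close>; this value is immaterial, because the objective is then infinite
  through the delay term.\<close>

definition tx_time :: "('k, 'r) uplink \<Rightarrow> 'k \<Rightarrow> 'r \<Rightarrow> real \<Rightarrow> ereal" where
  "tx_time s k n x = ereal (xi_d s + xi_M s) / ereal (rate s k n x)"

definition tx_energy :: "('k, 'r) uplink \<Rightarrow> 'k \<Rightarrow> 'r \<Rightarrow> real \<Rightarrow> ereal" where
  "tx_energy s k n x = ereal ((xi_d s + xi_M s) * x) / ereal (rate s k n x)"

lemma tx_time_zero: "xi_d s > 0 \<Longrightarrow> xi_M s > 0 \<Longrightarrow> tx_time s k n 0 = \<infinity>"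
  by (simp add: tx_time_def rate_def divide_ereal_def)

text \<open>In the extended reals \<open>0 * \<infinity> = 0\<close>, so terms with \<open>a k n = 0\<close> vanish.\<close>

definition Q2 ::
  "('k::finite, 'r::finite) uplink \<Rightarrow> ('k \<Rightarrow> 'r \<Rightarrow> real) \<Rightarrow> ('k \<Rightarrow> real) \<Rightarrow> ereal" where
  "Q2 s a p =
     ereal (\<Sum>k\<in>UNIV. \<Sum>n\<in>UNIV. a k n * delta s k)
     + ereal (rho1 s) * (\<Sum>k\<in>UNIV. \<Sum>n\<in>UNIV. ereal (a k n) * tx_energy s k n (p k))
     + ereal (rho2 s) * (MAX k. \<Sum>n\<in>UNIV. ereal (a k n) * tx_time s k n (p k))"

definition scheduled :: "('k \<Rightarrow> 'r::finite \<Rightarrow> real) \<Rightarrow> 'k set" where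
  "scheduled a = {k. (\<Sum>n\<in>UNIV. a k n) = 1}"

text \<open>The last conjunct is the convention that users without a resource block do not transmit.\<close>

definition sp2_feasible ::
  "('k::finite, 'r::finite) uplink \<Rightarrow> ('k \<Rightarrow> 'r \<Rightarrow> real) \<Rightarrow> ('k \<Rightarrow> real) \<Rightarrow> bool" where
  "sp2_feasible s a p \<longleftrightarrow>
     (\<forall>k. 0 \<le> p k \<and> p k \<le> pmax s k) \<and>
     (\<forall>k n. a k n \<in> {0, 1}) \<and>
     (\<forall>k. (\<Sum>n\<in>UNIV. a k n) \<le> 1) \<and>
     (\<forall>n. (\<Sum>k\<in>UNIV. a k n) \<le> 1) \<and>
     (\<forall>k. k \<notin> scheduled a \<longrightarrow> p k = 0)"

definition sp2_optimal ::
  "('k::finite, 'r::finite) uplink \<Rightarrow> ('k \<Rightarrow> 'r \<Rightarrow> real) \<Rightarrow> ('k \<Rightarrow> real) \<Rightarrow> bool" where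
  "sp2_optimal s a p \<longleftrightarrow>
     is_arg_min (\<lambda>(a, p). Q2 s a p) (\<lambda>(a, p). sp2_feasible s a p) (a, p)"

definition assigned_rb :: "('k \<Rightarrow> 'r \<Rightarrow> real) \<Rightarrow> 'k \<Rightarrow> 'r" where
  "assigned_rb a k = (THE n. a k n = 1)"

text \<open>The power control problem for the allocation \<open>a\<close> in which user \<open>l\<close> is the
  communication straggler. Its variables are the powers of the scheduled users,
  extended by 0 to all users.\<close>

definition straggler_objective ::
  "('k::finite, 'r::finite) uplink \<Rightarrow> ('k \<Rightarrow> 'r \<Rightarrow> real) \<Rightarrow> 'k \<Rightarrow> ('k \<Rightarrow> real) \<Rightarrow> ereal" where
  "straggler_objective s a l p =
     ereal (rho1 s) * (\<Sum>k\<in>scheduled a. tx_energy s k (assigned_rb a k) (p k))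
     + ereal (rho2 s) * tx_time s l (assigned_rb a l) (p l)"

definition straggler_feasible ::
  "('k::finite, 'r::finite) uplink \<Rightarrow> ('k \<Rightarrow> 'r \<Rightarrow> real) \<Rightarrow> 'k \<Rightarrow> ('k \<Rightarrow> real) \<Rightarrow> bool" where
  "straggler_feasible s a l p \<longleftrightarrow>
     (\<forall>k\<in>scheduled a.
        noise s (assigned_rb a k) * gain s l / (noise s (assigned_rb a l) * gain s k) * p l \<le> p k \<and>
        0 \<le> p k \<and> p k \<le> pmax s k) \<and>
     (\<forall>k. k \<notin> scheduled a \<longrightarrow> p k = 0)"

definition straggler_optimal ::
  "('k::finite, 'r::finite) uplink \<Rightarrow> ('k \<Rightarrow> 'r \<Rightarrow> real) \<Rightarrow> 'k \<Rightarrow> ('k \<Rightarrow> real) \<Rightarrow> bool" where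
  "straggler_optimal s a l p \<longleftrightarrow>
     is_arg_min (straggler_objective s a l) (straggler_feasible s a l) p"

end

theory Submission
  imports Defs
begin

text \<open>The energy of a user is strictly increasing in its power, so in an optimal solution every
  scheduled user transmits at the signal-to-noise ratio \<open>\<gamma>\<close> of the straggler. What
  remains is to minimise a positive affine function of \<open>\<gamma>\<close> divided by
  \<open>log 2 (1 + \<gamma>)\<close>; strict concavity of the logarithm makes the minimiser unique,
  and it does not depend on who the straggler is. Hence all \<open>p\<^sub>l\<close> coincide. On the other
  hand, \<open>Q\<^sub>2\<close> is, up to an additive constant, the straggler objective of the scheduled user
  with the smallest ratio.\<close>

section \<open>Strict concavity of the logarithm and the resulting one-variable facts\<close>

lemma log_strict_concave:
  fixes x y u v :: real
  assumes "b > 1" "0 < x" "0 < y" "x \<noteq> y" "0 < u" "0 < v" "u + v = 1"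
  shows "u * log b x + v * log b y < log b (u * x + v * y)"
proof -
  define m where "m = u * x + v * y"
  have m: "m > 0" using assms by (simp add: m_def add_pos_pos)
  \<comment> \<open>The tangent bound ln t <= t - 1 is used at t = x / m and t = y / m; with weights
    \<open>u\<close> and \<open>v\<close> the right-hand sides add up to 0. The bound is strict for
    t different from 1, so \<open>m\<close> must differ from \<open>x\<close>.\<close>
  have "m \<noteq> x"
  proof
    assume "m = x"
    moreover have "u = 1 - v" using assms(7) by simp
    ultimately have "v * y = v * x" by (simp add: m_def algebra_simps)
    then show False using assms by simp
  qed
  then have "ln (x / m) < x / m - 1"
    using ln_le_minus_one[of "x / m"] ln_eq_minus_one[of "x / m"] m assms
    by (simp add: less_le) (metis divide_eq_1_iff)
  then have "u * ln (x / m) < u * (x / m - 1)" using assms by simp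
  moreover have "v * ln (y / m) \<le> v * (y / m - 1)"
    using ln_le_minus_one[of "y / m"] m assms by simp
  moreover have "u * (x / m - 1) + v * (y / m - 1) = (u * x + v * y) / m - (u + v)"
    by (simp add: algebra_simps add_divide_distrib)
  moreover have "\<dots> = 0" using m assms by (simp flip: m_def)
  moreover have "u * ln (x / m) + v * ln (y / m) = u * ln x + v * ln y - (u + v) * ln m"
    using m assms(1-6) by (simp add: ln_div algebra_simps)
  ultimately have "u * ln x + v * ln y < ln m" using assms(7) by simp
  then have "(u * ln x + v * ln y) / ln b < ln m / ln b"
    using assms(1) by (simp add: divide_strict_right_mono)
  then show ?thesis by (simp add: log_def m_def add_divide_distrib)
qed

text \<open>The point 1 + x is the convex combination of 1 and 1 + y with weight x / y on the
  latter, and log 1 = 0. Equivalently, x / log 2 (1 + x) is strictly increasing, which makes energy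
  strictly increasing in power.\<close>

lemma mult_log_one_plus_less:
  fixes x y :: real
  assumes "0 < x" "x < y"
  shows "x * log 2 (1 + y) < y * log 2 (1 + x)"
proof -
  have "(x / y) * log 2 (1 + y) = (1 - x / y) * log 2 1 + (x / y) * log 2 (1 + y)" by simp
  also have "\<dots> < log 2 ((1 - x / y) * 1 + (x / y) * (1 + y))"
    using assms by (intro log_strict_concave) auto
  also have "(1 - x / y) * 1 + (x / y) * (1 + y) = 1 + x"
    using assms by (simp add: field_simps)
  finally have "(x / y) * log 2 (1 + y) < log 2 (1 + x)" .
  then show ?thesis using assms by (simp add: field_simps)
qed

text \<open>Two minimisers share the minimum \<phi> > 0, so the numerator equals \<phi> times the
  logarithm at both. At their midpoint the affine numerator is the average of these two values,
  while strict concavity puts \<phi> times the logarithm above that average. The quotient there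
  would be below \<phi>.\<close>

lemma affine_over_log_unique_min:
  fixes A B \<Gamma> :: real
  assumes "A > 0" "B > 0" and x: "0 < x" "x \<le> \<Gamma>" and y: "0 < y" "y \<le> \<Gamma>"
    and minx: "\<And>z. 0 < z \<Longrightarrow> z \<le> \<Gamma> \<Longrightarrow> (A * x + B) / log 2 (1 + x) \<le> (A * z + B) / log 2 (1 + z)"
    and miny: "\<And>z. 0 < z \<Longrightarrow> z \<le> \<Gamma> \<Longrightarrow> (A * y + B) / log 2 (1 + y) \<le> (A * z + B) / log 2 (1 + z)"
  shows "x = y"
proof (rule ccontr)
  assume ne: "x \<noteq> y"
  define \<phi> where "\<phi> = (A * x + B) / log 2 (1 + x)"
  define z where "z = (x + y) / 2"
  have z: "0 < z" "z \<le> \<Gamma>" using x y by (auto simp: z_def)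
  have \<phi>y: "\<phi> = (A * y + B) / log 2 (1 + y)"
    using minx[OF y] miny[OF x] by (simp add: \<phi>_def)
  have pos: "log 2 (1 + x) > 0" "log 2 (1 + y) > 0" "log 2 (1 + z) > 0" using x y z by auto
  have "\<phi> > 0" using assms(1,2) x pos by (simp add: \<phi>_def add_pos_pos)
  have "A * x + B = \<phi> * log 2 (1 + x)" "A * y + B = \<phi> * log 2 (1 + y)"
    using pos by (simp add: \<phi>_def, simp add: \<phi>y)
  then have "A * z + B = \<phi> * (1/2 * log 2 (1 + x) + 1/2 * log 2 (1 + y))"
    by (simp add: z_def field_simps)
  moreover have "1/2 * log 2 (1 + x) + 1/2 * log 2 (1 + y) < log 2 (1/2 * (1 + x) + 1/2 * (1 + y))"
    using x y ne by (intro log_strict_concave) auto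
  moreover have "1/2 * (1 + x) + 1/2 * (1 + y) = 1 + z" by (simp add: z_def field_simps)
  ultimately have "A * z + B < \<phi> * log 2 (1 + z)" using \<open>\<phi> > 0\<close> by simp
  then have "(A * z + B) / log 2 (1 + z) < \<phi>" using pos by (simp add: divide_less_eq)
  then show False using minx[OF z] by (simp add: \<phi>_def)
qed

section \<open>Sums over a binary allocation\<close>

lemma allocation_sum:
  fixes a :: "'k \<Rightarrow> 'r::finite \<Rightarrow> real" and f :: "'r \<Rightarrow> ereal"
  assumes bin: "\<And>n. a k n \<in> {0, 1}" and le: "(\<Sum>n\<in>UNIV. a k n) \<le> 1"
  shows "(\<Sum>n\<in>UNIV. ereal (a k n) * f n) = (if k \<in> scheduled a then f (assigned_rb a k) else 0)"
proof -
  have nonneg: "0 \<le> a k n" for n using bin[of n] by auto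
  show ?thesis
  proof (cases "\<exists>n. a k n = 1")
    case True
    then obtain m where m: "a k m = 1" by blast
    \<comment> \<open>One entry equal to 1 exhausts the bound on the row sum, so the other entries,
      being nonnegative, all vanish. Their products with \<open>f n\<close> are 0 even where
      \<open>f n\<close> is infinite.\<close>
    have split: "(\<Sum>n\<in>UNIV. a k n) = 1 + (\<Sum>n\<in>UNIV - {m}. a k n)"
      by (simp add: sum.remove[of UNIV m] m)
    then have "(\<Sum>n\<in>UNIV - {m}. a k n) = 0"
      using le sum_nonneg[of "UNIV - {m}" "a k"] nonneg by auto
    then have rest: "a k n = 0" if "n \<noteq> m" for n
      using that nonneg by (subst (asm) sum_nonneg_eq_0_iff) auto
    have "k \<in> scheduled a" using split \<open>(\<Sum>n\<in>UNIV - {m}. a k n) = 0\<close> by (simp add: scheduled_def)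
    moreover have "assigned_rb a k = m"
      unfolding assigned_rb_def using m rest by (intro the_equality) force+
    moreover have "(\<Sum>n\<in>UNIV. ereal (a k n) * f n) = f m"
      by (simp add: sum.remove[of UNIV m] m rest flip: one_ereal_def zero_ereal_def)
    ultimately show ?thesis by simp
  next
    case False
    then have "a k n = 0" for n using bin[of n] by auto
    then show ?thesis by (simp add: scheduled_def flip: zero_ereal_def)
  qed
qed

section \<open>Signal-to-noise ratios, transmission times and energies\<close>

definition snr :: "('k, 'r) uplink \<Rightarrow> ('k \<Rightarrow> 'r \<Rightarrow> real) \<Rightarrow> 'k \<Rightarrow> real \<Rightarrow> real" where
  "snr s a k x = gain s k * x / noise s (assigned_rb a k)"

text \<open>Inverts \<open>snr\<close> at every scheduled user, so that \<gamma> alone parametrises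
  the candidates for an optimum; the value 0 elsewhere respects the convention for users without a
  resource block.\<close>

definition common_snr_power ::
  "('k, 'r::finite) uplink \<Rightarrow> ('k \<Rightarrow> 'r \<Rightarrow> real) \<Rightarrow> real \<Rightarrow> 'k \<Rightarrow> real" where
  "common_snr_power s a \<gamma> k =
     (if k \<in> scheduled a then \<gamma> * noise s (assigned_rb a k) / gain s k else 0)"

locale uplink_problem =
  fixes s :: "('k::finite, 'r::finite) uplink"
  assumes rho1_pos: "rho1 s > 0" and rho2_pos: "rho2 s > 0"
    and xi_d_pos: "xi_d s > 0" and xi_M_pos: "xi_M s > 0"
    and W_U_pos: "W_U s > 0" and N_0_pos: "N_0 s > 0"
    and gain_pos: "\<And>k. gain s k > 0" and pmax_pos: "\<And>k. pmax s k > 0"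
    and interf_nonneg: "\<And>n. interf s n \<ge> 0"
begin

lemma noise_pos: "noise s n > 0"
  using interf_nonneg[of n] W_U_pos N_0_pos by (simp add: noise_def add_nonneg_pos)

lemma rate_snr: "rate s k (assigned_rb a k) x = W_U s * log 2 (1 + snr s a k x)"
  by (simp add: rate_def snr_def)

lemma snr_mono_iff: "snr s a k x \<le> snr s a k y \<longleftrightarrow> x \<le> y"
  using gain_pos[of k] noise_pos[of "assigned_rb a k"] by (simp add: snr_def divide_le_cancel)

lemma snr_less_iff: "snr s a k x < snr s a k y \<longleftrightarrow> x < y"
  using snr_mono_iff[of a k y x] by (simp add: not_le[symmetric])

lemma snr_zero: "snr s a k 0 = 0"
  by (simp add: snr_def)

lemma snr_pos_iff: "0 < snr s a k x \<longleftrightarrow> 0 < x"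
  using snr_less_iff[of a k 0 x] by (simp add: snr_zero)

lemma snr_common_snr_power: "k \<in> scheduled a \<Longrightarrow> snr s a k (common_snr_power s a \<gamma> k) = \<gamma>"
  using gain_pos[of k] noise_pos[of "assigned_rb a k"]
  by (simp add: snr_def common_snr_power_def)

text \<open>The factor in the constraint is the ratio of the two noise-to-gain quotients. In terms
  of \<open>snr\<close> the constraint therefore only says that no scheduled user has a smaller
  ratio than the straggler.\<close>

lemma straggler_constraint_iff:
  "noise s (assigned_rb a k) * gain s l / (noise s (assigned_rb a l) * gain s k) * x \<le> y
    \<longleftrightarrow> snr s a l x \<le> snr s a k y"
  using gain_pos[of k] gain_pos[of l] noise_pos[of "assigned_rb a k"] noise_pos[of "assigned_rb a l"]
  by (simp add: snr_def field_simps)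

lemma straggler_feasible_iff:
  "straggler_feasible s a l p \<longleftrightarrow>
     (\<forall>k\<in>scheduled a. snr s a l (p l) \<le> snr s a k (p k) \<and> 0 \<le> p k \<and> p k \<le> pmax s k) \<and>
     (\<forall>k. k \<notin> scheduled a \<longrightarrow> p k = 0)"
  unfolding straggler_feasible_def straggler_constraint_iff ..

lemma tx_time_pos:
  assumes "x > 0"
  shows "tx_time s k (assigned_rb a k) x
    = ereal ((xi_d s + xi_M s) / (W_U s * log 2 (1 + snr s a k x)))"
proof -
  have "log 2 (1 + snr s a k x) > 0" using assms snr_pos_iff[of a k x] by auto
  then show ?thesis using W_U_pos by (simp add: tx_time_def rate_snr)
qed

lemma tx_energy_pos:
  assumes "x > 0"
  shows "tx_energy s k (assigned_rb a k) x
    = ereal ((xi_d s + xi_M s) * x / (W_U s * log 2 (1 + snr s a k x)))"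
proof -
  have "log 2 (1 + snr s a k x) > 0" using assms snr_pos_iff[of a k x] by auto
  then show ?thesis using W_U_pos by (simp add: tx_energy_def rate_snr)
qed

lemma tx_time_at_zero: "tx_time s k n 0 = \<infinity>"
  by (rule tx_time_zero[OF xi_d_pos xi_M_pos])

lemma tx_energy_nonneg:
  assumes "x \<ge> 0"
  shows "0 \<le> tx_energy s k (assigned_rb a k) x"
proof (cases "x = 0")
  case False
  then have "x > 0" using assms by simp
  moreover have "log 2 (1 + snr s a k x) > 0" using \<open>x > 0\<close> snr_pos_iff[of a k x] by auto
  ultimately show ?thesis using W_U_pos xi_d_pos xi_M_pos by (simp add: tx_energy_pos)
qed (simp add: tx_energy_def rate_def divide_ereal_def zero_ereal_def[symmetric])

text \<open>All users share bandwidth and data size, so times of different users compare through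
  their ratios alone. Zero power on the right-hand side gives the bound \<infinity>.\<close>

lemma tx_time_antimono:
  assumes "0 \<le> x" "snr s a l x \<le> snr s a k y"
  shows "tx_time s k (assigned_rb a k) y \<le> tx_time s l (assigned_rb a l) x"
proof (cases "x = 0")
  case True
  then show ?thesis by (simp add: tx_time_at_zero)
next
  case False
  then have x: "x > 0" using assms by simp
  then have "0 < snr s a l x" by (simp add: snr_pos_iff)
  then have y: "y > 0" using assms(2) snr_pos_iff[of a k y] by linarith
  have "log 2 (1 + snr s a l x) > 0" using \<open>0 < snr s a l x\<close> by simp
  moreover have "log 2 (1 + snr s a l x) \<le> log 2 (1 + snr s a k y)"
    using \<open>0 < snr s a l x\<close> assms(2) by simp
  ultimately show ?thesis
    using x y W_U_pos xi_d_pos xi_M_pos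
    by (simp add: tx_time_pos) (intro divide_left_mono mult_left_mono mult_pos_pos; simp)
qed

lemma tx_time_nonneg:
  assumes "0 \<le> x"
  shows "0 \<le> tx_time s k (assigned_rb a k) x"
proof (cases "x = 0")
  case False
  then have "x > 0" using assms by simp
  moreover have "log 2 (1 + snr s a k x) > 0" using \<open>x > 0\<close> snr_pos_iff[of a k x] by auto
  ultimately show ?thesis using W_U_pos xi_d_pos xi_M_pos by (simp add: tx_time_pos)
qed (simp add: tx_time_at_zero)

section \<open>\<open>Q2\<close> and the values of the straggler objective\<close>

lemma Q2_eq_straggler_objective:
  assumes bin: "\<And>k n. a k n \<in> {0, 1}" and le: "\<And>k. (\<Sum>n\<in>UNIV. a k n) \<le> 1"
    and l: "l \<in> scheduled a" and p: "straggler_feasible s a l p"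
  shows "Q2 s a p = ereal (\<Sum>k\<in>UNIV. \<Sum>n\<in>UNIV. a k n * delta s k) + straggler_objective s a l p"
proof -
  have alloc: "(\<Sum>n\<in>UNIV. ereal (a k n) * f n)
      = (if k \<in> scheduled a then f (assigned_rb a k) else 0)" for k and f :: "'r \<Rightarrow> ereal"
    by (intro allocation_sum bin le)
  \<comment> \<open>Feasibility gives \<open>l\<close> the smallest ratio among scheduled users,
    hence the largest time. Unscheduled users enter the maximum with 0, which is no larger because
    times are nonnegative.\<close>
  have "(MAX k. \<Sum>n\<in>UNIV. ereal (a k n) * tx_time s k n (p k)) = tx_time s l (assigned_rb a l) (p l)"
  proof (rule Max_eqI)
    show "tx_time s l (assigned_rb a l) (p l)
        \<in> range (\<lambda>k. \<Sum>n\<in>UNIV. ereal (a k n) * tx_time s k n (p k))"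
      unfolding alloc using l by (intro range_eqI[of _ _ l]) simp
  next
    fix t assume "t \<in> range (\<lambda>k. \<Sum>n\<in>UNIV. ereal (a k n) * tx_time s k n (p k))"
    then obtain k where t: "t = (if k \<in> scheduled a then tx_time s k (assigned_rb a k) (p k) else 0)"
      unfolding alloc by blast
    show "t \<le> tx_time s l (assigned_rb a l) (p l)"
      using p l tx_time_antimono[of "p l" a l k "p k"] tx_time_nonneg[of "p l" l a]
      by (auto simp: t straggler_feasible_iff)
  qed simp
  moreover have "(\<Sum>k\<in>UNIV. \<Sum>n\<in>UNIV. ereal (a k n) * tx_energy s k n (p k))
      = (\<Sum>k\<in>scheduled a. tx_energy s k (assigned_rb a k) (p k))"
    by (simp add: alloc sum.If_cases)
  ultimately show ?thesis
    by (simp add: Q2_def straggler_objective_def add.assoc)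
qed

lemma straggler_objective_pos:
  assumes "\<And>k. k \<in> scheduled a \<Longrightarrow> p k > 0" and "l \<in> scheduled a"
  shows "straggler_objective s a l p = ereal
    (rho1 s * (\<Sum>k\<in>scheduled a. (xi_d s + xi_M s) * p k / (W_U s * log 2 (1 + snr s a k (p k))))
     + rho2 s * ((xi_d s + xi_M s) / (W_U s * log 2 (1 + snr s a l (p l)))))"
  using assms by (simp add: straggler_objective_def tx_time_pos tx_energy_pos)

lemma straggler_objective_zero:
  assumes "straggler_feasible s a l p" "p l = 0"
  shows "straggler_objective s a l p = \<infinity>"
proof -
  have "0 \<le> (\<Sum>k\<in>scheduled a. tx_energy s k (assigned_rb a k) (p k))"
    using assms by (intro sum_nonneg tx_energy_nonneg) (auto simp: straggler_feasible_iff)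
  then have "0 \<le> ereal (rho1 s) * (\<Sum>k\<in>scheduled a. tx_energy s k (assigned_rb a k) (p k))"
    using rho1_pos by (intro ereal_0_le_mult) auto
  then show ?thesis
    using assms rho2_pos by (auto simp: straggler_objective_def tx_time_at_zero)
qed

section \<open>The straggler objective at a common signal-to-noise ratio\<close>

lemma common_snr_power_pos: "k \<in> scheduled a \<Longrightarrow> \<gamma> > 0 \<Longrightarrow> common_snr_power s a \<gamma> k > 0"
  using gain_pos[of k] noise_pos by (simp add: common_snr_power_def)

lemma straggler_feasible_common_snr_power:
  assumes "0 < \<gamma>" "\<And>k. k \<in> scheduled a \<Longrightarrow> \<gamma> \<le> snr s a k (pmax s k)" "l \<in> scheduled a"
  shows "straggler_feasible s a l (common_snr_power s a \<gamma>)"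
proof -
  have "common_snr_power s a \<gamma> k \<le> pmax s k" if "k \<in> scheduled a" for k
    using assms(2)[OF that] snr_mono_iff[of a k "common_snr_power s a \<gamma> k" "pmax s k"]
    by (simp add: snr_common_snr_power that)
  moreover have "0 \<le> common_snr_power s a \<gamma> k" if "k \<in> scheduled a" for k
    using common_snr_power_pos[OF that assms(1)] by simp
  ultimately show ?thesis
    using assms(3)
    by (simp add: straggler_feasible_iff snr_common_snr_power) (simp add: common_snr_power_def)
qed

text \<open>The right-hand side does not mention \<open>l\<close>: on these power vectors all
  straggler problems become the same problem in \<gamma>, of the form treated in
  \<open>affine_over_log_unique_min\<close> up to a positive factor.\<close>

lemma straggler_objective_common_snr_power:
  assumes "0 < \<gamma>" "l \<in> scheduled a"
  shows "straggler_objective s a l (common_snr_power s a \<gamma>) = ereal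
    ((xi_d s + xi_M s) / W_U s *
      ((rho1 s * (\<Sum>k\<in>scheduled a. noise s (assigned_rb a k) / gain s k) * \<gamma> + rho2 s)
       / log 2 (1 + \<gamma>)))"
proof -
  let ?c = "xi_d s + xi_M s" and ?L = "W_U s * log 2 (1 + \<gamma>)"
  have "(\<Sum>k\<in>scheduled a. ?c * common_snr_power s a \<gamma> k
        / (W_U s * log 2 (1 + snr s a k (common_snr_power s a \<gamma> k))))
      = (\<Sum>k\<in>scheduled a. ?c * \<gamma> / ?L * (noise s (assigned_rb a k) / gain s k))"
    by (intro sum.cong refl) (simp add: snr_common_snr_power, simp add: common_snr_power_def mult_ac)
  also have "\<dots> = ?c * \<gamma> / ?L * (\<Sum>k\<in>scheduled a. noise s (assigned_rb a k) / gain s k)"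
    by (simp add: sum_distrib_left)
  finally show ?thesis
    using assms
    by (subst straggler_objective_pos)
       (auto intro: common_snr_power_pos simp: snr_common_snr_power field_simps add_divide_distrib)
qed

text \<open>Lowering every scheduled power to the straggler's ratio leaves the delay term unchanged
  and strictly reduces the energy of each user whose power changes.\<close>

lemma straggler_objective_common_snr_power_less:
  assumes p: "straggler_feasible s a l p" and l: "l \<in> scheduled a" and pl: "p l > 0"
    and ne: "p \<noteq> common_snr_power s a (snr s a l (p l))"
  shows "straggler_objective s a l (common_snr_power s a (snr s a l (p l))) < straggler_objective s a l p"
proof -
  define \<gamma> where "\<gamma> = snr s a l (p l)"
  define q where "q = common_snr_power s a \<gamma>"
  \<comment> \<open>All scheduled powers are positive here, so the energies are finite; as real
    numbers they allow strict comparison of sums.\<close>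
  define e where "e k x = (xi_d s + xi_M s) * x / (W_U s * log 2 (1 + snr s a k x))" for k x
  have \<gamma>: "\<gamma> > 0" using pl by (simp add: \<gamma>_def snr_pos_iff)
  have qpos: "q k > 0" if "k \<in> scheduled a" for k
    using common_snr_power_pos[OF that \<gamma>] by (simp add: q_def)
  have snrq: "snr s a k (q k) = \<gamma>" if "k \<in> scheduled a" for k
    using that by (simp add: q_def snr_common_snr_power)
  have qp: "q k \<le> p k" if "k \<in> scheduled a" for k
    using p that snr_mono_iff[of a k "q k" "p k"] by (simp add: snrq straggler_feasible_iff \<gamma>_def)
  have ppos: "p k > 0" if "k \<in> scheduled a" for k
    using qpos[OF that] qp[OF that] by linarith
  have strict: "e k (q k) < e k (p k)" if k: "k \<in> scheduled a" and "q k \<noteq> p k" for k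
  proof -
    let ?w = "noise s (assigned_rb a k) / gain s k"
    have w: "?w > 0" using gain_pos noise_pos by simp
    \<comment> \<open>Writing power as a fixed multiple of the ratio turns the energy into a
      positive constant times \<gamma> / log 2 (1 + \<gamma>), which
      \<open>mult_log_one_plus_less\<close> compares.\<close>
    have x: "x = ?w * snr s a k x" for x
      using gain_pos[of k] noise_pos[of "assigned_rb a k"] by (simp add: snr_def)
    let ?y = "snr s a k (p k)"
    have y: "\<gamma> < ?y"
      using qp[OF k] that(2) snr_less_iff[of a k "q k" "p k"] by (simp add: snrq[OF k])
    have L: "log 2 (1 + \<gamma>) > 0" "log 2 (1 + ?y) > 0" using \<gamma> y by auto
    have "\<gamma> / log 2 (1 + \<gamma>) < ?y / log 2 (1 + ?y)"
      using mult_log_one_plus_less[OF \<gamma> y] L by (simp add: divide_simps mult.commute)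
    then have "(xi_d s + xi_M s) * ?w / W_U s * (\<gamma> / log 2 (1 + \<gamma>))
        < (xi_d s + xi_M s) * ?w / W_U s * (?y / log 2 (1 + ?y))"
      using w xi_d_pos xi_M_pos W_U_pos
      by (intro mult_strict_left_mono divide_pos_pos[OF mult_pos_pos]) auto
    moreover have "e k (q k) = (xi_d s + xi_M s) * ?w / W_U s * (\<gamma> / log 2 (1 + \<gamma>))"
      unfolding e_def snrq[OF k] by (subst x[of "q k"]) (simp add: snrq[OF k])
    moreover have "e k (p k) = (xi_d s + xi_M s) * ?w / W_U s * (?y / log 2 (1 + ?y))"
      unfolding e_def by (subst (1) x[of "p k"]) simp
    ultimately show ?thesis by simp
  qed
  \<comment> \<open>Both vectors vanish at unscheduled users, so they must differ at a scheduled
    one.\<close>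
  have "\<exists>k\<in>scheduled a. q k \<noteq> p k"
  proof (rule ccontr)
    assume "\<not> ?thesis"
    then have "p = q"
      using p by (intro ext) (auto simp: straggler_feasible_iff q_def common_snr_power_def)
    then show False using ne by (simp add: q_def \<gamma>_def)
  qed
  then have "(\<Sum>k\<in>scheduled a. e k (q k)) < (\<Sum>k\<in>scheduled a. e k (p k))"
    using strict by (intro sum_strict_mono_ex1) (auto simp: less_imp_le, metis order.refl less_imp_le)
  moreover have "snr s a l (q l) = snr s a l (p l)" using l by (simp add: snrq \<gamma>_def)
  ultimately have "straggler_objective s a l q < straggler_objective s a l p"
    using rho1_pos by (simp add: straggler_objective_pos qpos ppos l flip: e_def)
  then show ?thesis by (simp add: q_def \<gamma>_def)
qed

section \<open>Form and uniqueness of the optimal straggler powers\<close>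

lemma straggler_optimal_common_snr:
  assumes opt: "straggler_optimal s a l p" and l: "l \<in> scheduled a"
  defines "\<gamma> \<equiv> snr s a l (p l)"
  shows "p = common_snr_power s a \<gamma>" "0 < \<gamma>" "\<And>k. k \<in> scheduled a \<Longrightarrow> \<gamma> \<le> snr s a k (pmax s k)"
proof -
  have p: "straggler_feasible s a l p"
    and best: "\<And>q. straggler_feasible s a l q \<Longrightarrow> \<not> straggler_objective s a l q < straggler_objective s a l p"
    using opt by (auto simp: straggler_optimal_def is_arg_min_def)
  show \<gamma>_le: "\<gamma> \<le> snr s a k (pmax s k)" if "k \<in> scheduled a" for k
  proof -
    have "\<gamma> \<le> snr s a k (p k)" using p that by (simp add: \<gamma>_def straggler_feasible_iff)
    also have "\<dots> \<le> snr s a k (pmax s k)"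
      using p that by (simp add: snr_mono_iff straggler_feasible_iff)
    finally show ?thesis .
  qed
  have "p l > 0"
  proof (rule ccontr)
    assume "\<not> p l > 0"
    then have "p l = 0" using p l by (force simp: straggler_feasible_iff)
    then have inf: "straggler_objective s a l p = \<infinity>" using straggler_objective_zero[OF p] by simp
    \<comment> \<open>The largest ratio that all scheduled users can reach together within their
      power limits. It is positive and yields a feasible vector of finite cost, whereas zero
      straggler power costs \<infinity>.\<close>
    define \<Gamma> where "\<Gamma> = Min ((\<lambda>k. snr s a k (pmax s k)) ` scheduled a)"
    have "\<Gamma> \<in> (\<lambda>k. snr s a k (pmax s k)) ` scheduled a"
      unfolding \<Gamma>_def using l by (intro Min_in) auto
    then have "\<Gamma> > 0" using pmax_pos by (auto simp: snr_pos_iff)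
    moreover have "\<Gamma> \<le> snr s a k (pmax s k)" if "k \<in> scheduled a" for k
      unfolding \<Gamma>_def using that by simp
    ultimately have "straggler_feasible s a l (common_snr_power s a \<Gamma>)"
      using l by (intro straggler_feasible_common_snr_power)
    from best[OF this] show False
      using inf l \<open>\<Gamma> > 0\<close> by (simp add: straggler_objective_common_snr_power)
  qed
  then show "0 < \<gamma>" by (simp add: \<gamma>_def snr_pos_iff)
  then have "straggler_feasible s a l (common_snr_power s a \<gamma>)"
    using \<gamma>_le l by (intro straggler_feasible_common_snr_power)
  then show "p = common_snr_power s a \<gamma>"
    using best straggler_objective_common_snr_power_less[OF p l \<open>p l > 0\<close>] by (auto simp: \<gamma>_def)
qed

text \<open>Both solutions have a common ratio that minimises the same quotient on the interval from
  0 (excluded) to \<Gamma>, whichever user is the straggler. So the ratios agree, and with them the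
  power vectors.\<close>

lemma straggler_optimal_unique:
  assumes "straggler_optimal s a l p" "l \<in> scheduled a"
    and "straggler_optimal s a l' p'" "l' \<in> scheduled a"
  shows "p = p'"
proof -
  define A where "A = rho1 s * (\<Sum>k\<in>scheduled a. noise s (assigned_rb a k) / gain s k)"
  define \<Gamma> where "\<Gamma> = Min ((\<lambda>k. snr s a k (pmax s k)) ` scheduled a)"
  have \<Gamma>: "z \<le> \<Gamma> \<longleftrightarrow> (\<forall>k\<in>scheduled a. z \<le> snr s a k (pmax s k))" for z
    unfolding \<Gamma>_def using assms(2) by (subst Min_ge_iff) auto
  have "A > 0"
    unfolding A_def using assms(2) rho1_pos gain_pos noise_pos
    by (intro mult_pos_pos sum_pos) auto
  have minimal: "(A * snr s a m (q m) + rho2 s) / log 2 (1 + snr s a m (q m))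
      \<le> (A * z + rho2 s) / log 2 (1 + z)"
    if opt: "straggler_optimal s a m q" and m: "m \<in> scheduled a" and z: "0 < z" "z \<le> \<Gamma>" for m q z
  proof -
    note q = straggler_optimal_common_snr[OF opt m]
    have "straggler_feasible s a m (common_snr_power s a z)"
      using z m by (intro straggler_feasible_common_snr_power) (auto simp: \<Gamma>)
    then have "\<not> straggler_objective s a m (common_snr_power s a z) < straggler_objective s a m q"
      using opt by (auto simp: straggler_optimal_def is_arg_min_def)
    then have "(xi_d s + xi_M s) / W_U s *
        ((A * snr s a m (q m) + rho2 s) / log 2 (1 + snr s a m (q m)))
      \<le> (xi_d s + xi_M s) / W_U s * ((A * z + rho2 s) / log 2 (1 + z))"
      using m z q(2)
      by (subst (asm) q(1)) (simp add: straggler_objective_common_snr_power not_less flip: A_def)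
    moreover have "(xi_d s + xi_M s) / W_U s > 0" using xi_d_pos xi_M_pos W_U_pos by simp
    ultimately show ?thesis by (simp only: mult_le_cancel_left_pos)
  qed
  note p = straggler_optimal_common_snr[OF assms(1,2)]
  note p' = straggler_optimal_common_snr[OF assms(3,4)]
  have "snr s a l (p l) = snr s a l' (p' l')"
    using p(2,3) p'(2,3) minimal[OF assms(1,2)] minimal[OF assms(3,4)] \<open>A > 0\<close> rho2_pos
    by (intro affine_over_log_unique_min[of A "rho2 s" _ \<Gamma>]) (auto simp: \<Gamma>)
  then show ?thesis using p(1) p'(1) by simp
qed

section \<open>From the joint problem to the straggler problems\<close>

lemma sp2_optimal_imp_straggler_optimal:
  assumes opt: "sp2_optimal s a p" and ne: "scheduled a \<noteq> {}"
  obtains l where "l \<in> scheduled a" "straggler_optimal s a l p"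
proof -
  have feas: "sp2_feasible s a p"
    and best: "\<And>q. sp2_feasible s a q \<Longrightarrow> \<not> Q2 s a q < Q2 s a p"
    using opt by (auto simp: sp2_optimal_def is_arg_min_def)
  have bin: "\<And>k n. a k n \<in> {0, 1}" and le: "\<And>k. (\<Sum>n\<in>UNIV. a k n) \<le> 1"
    using feas by (auto simp: sp2_feasible_def)
  \<comment> \<open>The straggler is a scheduled user with the smallest ratio under
    \<open>p\<close>; this choice makes \<open>p\<close> feasible for its problem.\<close>
  obtain l where l: "l \<in> scheduled a" "\<And>k. k \<in> scheduled a \<Longrightarrow> snr s a l (p l) \<le> snr s a k (p k)"
    using ex_is_arg_min_if_finite[OF _ ne, of "\<lambda>k. snr s a k (p k)"]
    by (auto simp: is_arg_min_linorder)
  have p: "straggler_feasible s a l p"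
    using feas l(2) by (simp add: straggler_feasible_iff sp2_feasible_def)
  have "\<not> straggler_objective s a l q < straggler_objective s a l p"
    if q: "straggler_feasible s a l q" for q
  proof -
    have "0 \<le> q k \<and> q k \<le> pmax s k" for k
      using q pmax_pos[of k] by (cases "k \<in> scheduled a") (auto simp: straggler_feasible_iff)
    then have "sp2_feasible s a q"
      using feas q by (simp add: sp2_feasible_def straggler_feasible_iff)
    \<comment> \<open>Since \<open>p\<close> and \<open>q\<close> are both feasible for the same
      \<open>l\<close>, their \<open>Q2\<close> values differ from their straggler objectives by the
      same constant. It is finite and can be cancelled in the extended reals.\<close>
    from best[OF this] show ?thesis
      by (simp add: Q2_eq_straggler_objective[OF bin le l(1) p]
          Q2_eq_straggler_objective[OF bin le l(1) q] ereal_add_le_add_iff not_less)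
  qed
  with p l(1) that show ?thesis by (auto simp: straggler_optimal_def is_arg_min_def)
qed

end

theorem theorem4:
  fixes s :: "('k::finite, 'r::finite) uplink"
    and astar :: "'k \<Rightarrow> 'r \<Rightarrow> real"
    and pl :: "'k \<Rightarrow> 'k \<Rightarrow> real"
    and pstar :: "'k \<Rightarrow> real"
  assumes "rho1 s > 0" and "rho2 s > 0" and "xi_d s > 0" and "xi_M s > 0"
    and "W_U s > 0" and "N_0 s > 0"
    and "\<And>k. gain s k > 0" and "\<And>k. pmax s k > 0" and "\<And>n. interf s n \<ge> 0"
    and "\<exists>p. sp2_optimal s astar p"
    and "scheduled astar \<noteq> {}"
    and "\<And>l. l \<in> scheduled astar \<Longrightarrow> straggler_optimal s astar l (pl l)"
    and "is_arg_min (Q2 s astar) (\<lambda>p. p \<in> pl ` scheduled astar) pstar"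
  shows "{p. sp2_optimal s astar p} = {pstar}"
proof -
  interpret uplink_problem s by unfold_locales (use assms in auto)
  obtain m where m: "m \<in> scheduled astar" "pstar = pl m"
    using assms(13) by (auto simp: is_arg_min_def)
  \<comment> \<open>An optimal \<open>p\<close> solves the problem of some straggler
    \<open>l\<close>, and \<open>pstar\<close> solves that of \<open>m\<close>; the two solutions
    coincide even when \<open>l\<close> and \<open>m\<close> differ. The assumed existence of an
    optimal power vector then gives equality of the sets.\<close>
  have "p = pstar" if opt: "sp2_optimal s astar p" for p
  proof -
    obtain l where "l \<in> scheduled astar" "straggler_optimal s astar l p"
      using sp2_optimal_imp_straggler_optimal[OF opt assms(11)] .
    then show ?thesis using straggler_optimal_unique assms(12)[OF m(1)] m by blast
  qed
  then show ?thesis using assms(10) by blast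
qed

end
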